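(* Let $P,Q\in\mathbb Z$ with $Q=\pm1$ and $\Delta=P^2+4Q>0$, and assume the Lucas sequence $U_n=U_n(P,Q)$ is nondegenerate. Let $k\ge2$, and assume the $abc$ conjecture over $K=\mathbb Q(\sqrt\Delta)$. Fix $A\in\mathbb Z\setminus\{0\}$. Then there exists a constant $C=C(P,Q,A,k)$ such that, whenever $n_1,\ldots,n_r$ are pairwise coprime positive integers ($r\ge1$ arbitrary) and $$A y^k=\prod_{i=1}^r U_{n_i}(P,Q)$$ for some $y\in\mathbb Z$, one has $\max_{1\le i\le r} n_i<C$. In particular, for fixed $A$ and $k$, only finitely many nontrivial pairwise coprime index tuples can occur, after deleting factors $U_1=1$ (i.e. after deleting the indices $n_i=1$).
   Context: The Lucas sequence $U_n=U_n(P,Q)$ is defined by $U_0=0$, $U_1=1$, $U_{n+2}=PU_{n+1}+QU_n$. Let $\alpha,\beta$ be the roots of $x^2-Px-Q$. The sequence is nondegenerate if $\alpha/\beta$ is not a root of unity (then $U_n\neq0$ for $n\ge1$, and $K=\mathbb Q(\sqrt\Delta)$ is a real quadratic field). The $abc$ conjecture over $K$: for every $\varepsilon>0$ there is a constant $C_{K,\varepsilon}$ such that for all triples $(a,b,c)$ of nonzero elements of $K$ with $a+b=c$, $$h(a:b:c)\le(1+\varepsilon)\operatorname{rad}_K(a:b:c)+C_{K,\varepsilon}.$$ Here $h(a:b:c)=\frac1{[K:\mathbb Q]}\sum_v\log\max\{|a|_v,|b|_v,|c|_v\}$, summed over all places $v$ of $K$, with absolute values normalised to satisfy the product formula ($|x|_v=|\sigma(x)|$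 for a real embedding $\sigma$, $|x|_{\mathfrak p}=(N\mathfrak p)^{-v_{\mathfrak p}(x)}$ for a nonzero prime ideal $\mathfrak p$ of $\mathcal O_K$, $N\mathfrak p=|\mathcal O_K/\mathfrak p|$); and $\operatorname{rad}_K(a:b:c)=\frac1{[K:\mathbb Q]}\sum_{\mathfrak p\in I(a,b,c)}\log N\mathfrak p$, where $I(a,b,c)$ is the set of nonzero prime ideals $\mathfrak p$ for which $v_{\mathfrak p}(a),v_{\mathfrak p}(b),v_{\mathfrak p}(c)$ are not all equal. *)

theory Defs
  imports "HOL-Analysis.Analysis" "HOL-Algebra.Algebra"
begin

section \<open>Lucas sequences\<close>

fun lucas_U :: "int \<Rightarrow> int \<Rightarrow> nat \<Rightarrow> int" where
  "lucas_U P Q 0 = 0"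
| "lucas_U P Q (Suc 0) = 1"
| "lucas_U P Q (Suc (Suc n)) = P * lucas_U P Q (Suc n) + Q * lucas_U P Q n"

text \<open>The hypothesis on \<open>\<alpha>\<close> and \<open>\<beta>\<close> says that they are the two roots of
  \<open>x\<^sup>2 - P x - Q\<close>, counted with multiplicity.\<close>

definition lucas_nondegenerate :: "int \<Rightarrow> int \<Rightarrow> bool" where
  "lucas_nondegenerate P Q \<longleftrightarrow>
     (\<forall>\<alpha> \<beta> :: complex.
        (\<forall>x. x\<^sup>2 - of_int P * x - of_int Q = (x - \<alpha>) * (x - \<beta>)) \<longrightarrow>
        \<not> (\<exists>n::nat. n > 0 \<and> (\<alpha> / \<beta>) ^ n = 1))"


section \<open>Real number fields\<close>

text \<open>A number field is represented by a set \<open>K\<close> of real numbers. The definitions are meant for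
  totally real \<open>K\<close>: there are no complex places in the height below.\<close>

definition quadratic_field :: "int \<Rightarrow> real set" where
  "quadratic_field D = {of_rat a + of_rat b * sqrt (of_int D) | a b :: rat. True}"

definition real_subring :: "real set \<Rightarrow> real ring" where
  "real_subring S = \<lparr>carrier = S, mult = (*), one = 1, ring.zero = 0, add = (+)\<rparr>"

definition field_degree :: "real set \<Rightarrow> nat" where
  "field_degree K = vector_space.dim (\<lambda>(q::rat) (x::real). of_rat q * x) K"

text \<open>The restriction to \<open>extensional K\<close> makes embeddings that agree on \<open>K\<close> equal as functions,
  so that each real place is counted once.\<close>

definition real_embeddings :: "real set \<Rightarrow> (real \<Rightarrow> real) set" where
  "real_embeddings K = ring_hom (real_subring K) (real_subring UNIV) \<inter> extensional K"

definition ring_of_integers :: "real set \<Rightarrow> real ring" where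
  "ring_of_integers K = real_subring {x \<in> K. algebraic_int x}"

definition finite_places :: "real set \<Rightarrow> real set set" where
  "finite_places K = {\<pp>. primeideal \<pp> (ring_of_integers K) \<and> \<pp> \<noteq> {0}}"

definition ideal_norm :: "real set \<Rightarrow> real set \<Rightarrow> nat" where
  "ideal_norm K \<pp> = card (carrier (ring_of_integers K Quot \<pp>))"

definition integral_valuation :: "real set \<Rightarrow> real set \<Rightarrow> real \<Rightarrow> nat" where
  "integral_valuation K \<pp> x = (GREATEST n. x \<in> \<pp> [^]\<^bsub>ideals_set (ring_of_integers K)\<^esub> n)"

text \<open>Every nonzero element of \<open>K\<close> is a quotient of nonzero integers, and the difference of
  valuations does not depend on the quotient. The value at \<open>0\<close> is unspecified and is never used.\<close>

definition valuation :: "real set \<Rightarrow> real set \<Rightarrow> real \<Rightarrow> int" where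
  "valuation K \<pp> x =
     (THE m. \<exists>a \<in> carrier (ring_of_integers K) - {0}. \<exists>b \<in> carrier (ring_of_integers K) - {0}.
        x = a / b \<and> m = int (integral_valuation K \<pp> a) - int (integral_valuation K \<pp> b))"

definition prime_abs :: "real set \<Rightarrow> real set \<Rightarrow> real \<Rightarrow> real" where
  "prime_abs K \<pp> x = (if x = 0 then 0 else real (ideal_norm K \<pp>) powi (- valuation K \<pp> x))"


section \<open>The abc conjecture over a totally real number field\<close>

text \<open>For nonzero \<open>a\<close>, \<open>b\<close>, \<open>c\<close> all but finitely many terms of the sum over the finite places
  vanish.\<close>

definition abc_height :: "real set \<Rightarrow> real \<Rightarrow> real \<Rightarrow> real \<Rightarrow> real" where
  "abc_height K a b c =
     1 / real (field_degree K) *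
       ((\<Sum>\<sigma>\<in>real_embeddings K. ln (Max {\<bar>\<sigma> a\<bar>, \<bar>\<sigma> b\<bar>, \<bar>\<sigma> c\<bar>})) +
        (\<Sum>\<^sub>\<infinity>\<pp>\<in>finite_places K. ln (Max {prime_abs K \<pp> a, prime_abs K \<pp> b, prime_abs K \<pp> c})))"

definition abc_support :: "real set \<Rightarrow> real \<Rightarrow> real \<Rightarrow> real \<Rightarrow> real set set" where
  "abc_support K a b c =
     {\<pp> \<in> finite_places K.
        \<not> (valuation K \<pp> a = valuation K \<pp> b \<and> valuation K \<pp> b = valuation K \<pp> c)}"

definition abc_radical :: "real set \<Rightarrow> real \<Rightarrow> real \<Rightarrow> real \<Rightarrow> real" where
  "abc_radical K a b c =
     1 / real (field_degree K) * (\<Sum>\<pp>\<in>abc_support K a b c. ln (real (ideal_norm K \<pp>)))"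

definition abc_conjecture :: "real set \<Rightarrow> bool" where
  "abc_conjecture K \<longleftrightarrow>
     (\<forall>\<epsilon>::real. \<epsilon> > 0 \<longrightarrow>
       (\<exists>C::real. \<forall>a \<in> K - {0}. \<forall>b \<in> K - {0}. \<forall>c \<in> K - {0}. a + b = c \<longrightarrow>
          abc_height K a b c \<le> (1 + \<epsilon>) * abc_radical K a b c + C))"


section \<open>Index tuples\<close>

text \<open>Coprimality is required between different positions, so the index \<open>1\<close> may be repeated.\<close>

definition coprime_index_tuple :: "nat list \<Rightarrow> bool" where
  "coprime_index_tuple ns \<longleftrightarrow>
     ns \<noteq> [] \<and> (\<forall>n\<in>set ns. n > 0) \<and>
     (\<forall>i<length ns. \<forall>j<length ns. i \<noteq> j \<longrightarrow> coprime (ns ! i) (ns ! j))"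

definition lucas_product_tuple :: "int \<Rightarrow> int \<Rightarrow> int \<Rightarrow> nat \<Rightarrow> nat list \<Rightarrow> bool" where
  "lucas_product_tuple P Q A k ns \<longleftrightarrow>
     coprime_index_tuple ns \<and> (\<exists>y::int. A * y ^ k = (\<Prod>n\<leftarrow>ns. lucas_U P Q n))"

end

theory Submission
  imports Defs
begin

text \<open>Since \<open>Q = \<plusminus>1\<close>, Lucas numbers with coprime indices are coprime (\<open>coprime_lucas_U\<close>). If their
  product is \<open>A y\<^sup>k\<close> with \<open>k \<ge> 2\<close>, then every prime that divides one factor \<open>U\<^sub>n\<close> but not \<open>A\<close> divides
  \<open>U\<^sub>n\<close> at least twice. So the product \<open>r\<close> of these primes satisfies \<open>r\<^sup>2 \<le> \<bar>U\<^sub>n\<bar>\<close>, and every prime divisor of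
  \<open>U\<^sub>n\<close> divides \<open>A r\<close> (\<open>powerful_part\<close>). Each index is thereby treated separately.

  Let \<open>D = P\<^sup>2 + 4 Q\<close>, let \<open>\<alpha>\<close>, \<open>\<beta>\<close> be the roots of \<open>x\<^sup>2 - P x - Q\<close> and \<open>M = max \<bar>\<alpha>\<bar> \<bar>\<beta>\<bar>\<close>; as \<open>\<bar>\<alpha> \<beta>\<bar> = 1\<close>
  and \<open>\<bar>\<alpha>\<bar> \<noteq> \<bar>\<beta>\<bar>\<close>, one has \<open>M > 1\<close>. The conjecture is applied to \<open>\<alpha>\<^sup>n - \<beta>\<^sup>n = \<surd>D U\<^sub>n\<close>
  (\<open>lucas_index_bounded\<close>). The powers of \<open>\<alpha>\<close> and \<open>\<beta>\<close> are units, and the nontrivial embedding exchanges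
  them, so the height is at least \<open>n ln M\<close> (\<open>abc_height_ge\<close>). A prime ideal counted in the radical contains
  \<open>\<surd>D U\<^sub>n\<close>, hence the integer \<open>m = D \<bar>A\<bar> r\<close>. The ring of integers modulo \<open>m\<close> has at most \<open>m\<^sup>2\<close> elements
  and maps onto the product of the residue fields of these prime ideals (\<open>prod_ideal_norm_le\<close>), so the
  radical is at most \<open>ln m\<close> (\<open>abc_radical_le\<close>), which by \<open>r\<^sup>2 \<le> \<bar>U\<^sub>n\<bar> \<le> 2 M\<^sup>n\<close> is at most \<open>(n / 2) ln M\<close> up to a
  constant. With \<open>\<epsilon> = 1/2\<close> this yields \<open>n ln M \<le> (3/4) n ln M + O(1)\<close>, which bounds \<open>n\<close>.

  The finiteness statement follows: after deleting the entries \<open>1\<close>, a pairwise coprime tuple has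
  distinct entries, all taken from a bounded range.\<close>

section \<open>Arithmetic of Lucas numbers\<close>

lemma lucas_U_add:
  "lucas_U P Q (m + Suc n) = lucas_U P Q (Suc m) * lucas_U P Q (Suc n) + Q * lucas_U P Q m * lucas_U P Q n"
proof (induction n arbitrary: m)
  case (Suc n)
  show ?case using Suc.IH[of "Suc m"] by (simp add: algebra_simps)
qed simp

lemma coprime_lucas_U_Suc:
  assumes "is_unit Q"
  shows "coprime (lucas_U P Q n) (lucas_U P Q (Suc n))"
proof (induction n)
  case (Suc n)
  have "gcd (lucas_U P Q (Suc n)) (lucas_U P Q (Suc (Suc n))) = gcd (lucas_U P Q (Suc n)) (Q * lucas_U P Q n)"
    by (metis add.commute gcd_add_mult lucas_U.simps(3))
  also have "\<dots> = 1"
    using Suc assms by (metis coprime_commute coprime_iff_gcd_eq_1 coprime_mult_right_iff is_unit_right_imp_coprime)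
  finally show ?case by (simp add: coprime_iff_gcd_eq_1)
qed simp

text \<open>The subtractive Euclidean algorithm on the indices: the addition formula gives
  \<open>gcd U\<^sub>a U\<^sub>b = gcd U\<^sub>a U\<^sub>c\<close> for \<open>b = c + a\<close>, because \<open>Q\<close> is a unit.\<close>

lemma coprime_lucas_U:
  assumes "is_unit Q" "coprime a b"
  shows "coprime (lucas_U P Q a) (lucas_U P Q b)"
  using assms(2)
proof (induction "a + b" arbitrary: a b rule: less_induct)
  case less
  have step: "coprime (lucas_U P Q a) (lucas_U P Q b)" if le: "a \<le> b" "a > 0" and ab: "coprime a b"
    and IH: "\<And>c. c < b \<Longrightarrow> coprime a c \<Longrightarrow> coprime (lucas_U P Q a) (lucas_U P Q c)" for a b
  proof -
    obtain a' where a: "a = Suc a'" using le(2) gr0_conv_Suc by blast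
    obtain c where b: "b = c + a" using le(1) by (metis add.commute le_Suc_ex)
    have "coprime a c" using ab b by (metis add.commute coprime_iff_gcd_eq_1 gcd_add2)
    then have ac: "coprime (lucas_U P Q a) (lucas_U P Q c)" using le(2) IH b by simp
    have "lucas_U P Q b = lucas_U P Q (Suc c) * lucas_U P Q a + Q * lucas_U P Q c * lucas_U P Q a'"
      unfolding b a by (rule lucas_U_add)
    then have "gcd (lucas_U P Q a) (lucas_U P Q b) = gcd (lucas_U P Q a) (Q * lucas_U P Q c * lucas_U P Q a')"
      by (metis gcd_add_mult add.commute)
    also have "\<dots> = 1"
      using ac coprime_lucas_U_Suc[OF assms(1), of P a'] assms(1) a
      by (metis coprime_commute coprime_iff_gcd_eq_1 coprime_mult_right_iff is_unit_right_imp_coprime)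
    finally show ?thesis by (simp add: coprime_iff_gcd_eq_1)
  qed
  show ?case
  proof (cases "a = 0 \<or> b = 0")
    case True
    then show ?thesis using less.prems by auto
  next
    case False
    show ?thesis
    proof (cases "a \<le> b")
      case True
      show ?thesis by (rule step) (use True False less in auto)
    next
      case F: False
      have "coprime (lucas_U P Q b) (lucas_U P Q a)"
      proof (rule step)
        show "coprime (lucas_U P Q b) (lucas_U P Q c)" if "c < a" "coprime b c" for c
          using less.hyps[of c b] that by (simp add: coprime_commute)
      qed (use F False less.prems in \<open>auto simp: coprime_commute\<close>)
      then show ?thesis by (simp add: coprime_commute)
    qed
  qed
qed

lemma lucas_U_binet:
  fixes \<alpha> \<beta> :: real
  assumes "\<alpha> + \<beta> = of_int P" "\<alpha> * \<beta> = - of_int Q"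
  shows "(\<alpha> - \<beta>) * of_int (lucas_U P Q n) = \<alpha> ^ n - \<beta> ^ n"
proof (induction n rule: induct_nat_012)
  case (ge2 n)
  have "\<alpha> ^ Suc (Suc n) - \<beta> ^ Suc (Suc n) = (\<alpha> + \<beta>) * (\<alpha> ^ Suc n - \<beta> ^ Suc n) - \<alpha> * \<beta> * (\<alpha> ^ n - \<beta> ^ n)"
    by (simp add: algebra_simps)
  then show ?case unfolding assms ge2.IH[symmetric] by (simp add: algebra_simps)
qed simp_all

text \<open>The prime divisors of \<open>u\<close> that do not divide \<open>A\<close> occur in \<open>u\<close> with an exponent that is a
  positive multiple of \<open>k\<close>; \<open>r\<close> is their product.\<close>

lemma powerful_part:
  fixes A y u v :: int
  assumes "A * y ^ k = u * v" "coprime u v" "k \<ge> 2" "u \<noteq> 0"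
  obtains r where "r > 0" "r\<^sup>2 dvd u" "\<And>p. p \<in> prime_factors u \<Longrightarrow> p dvd A * r"
proof -
  define S where "S = {p \<in> prime_factors u. \<not> p dvd A}"
  have fin: "finite S" by (simp add: S_def)
  note pr = in_prime_factors_imp_prime[of _ u]
  have sq: "p\<^sup>2 dvd u" if "p \<in> S" for p
  proof -
    have p: "p dvd u" "\<not> p dvd A" 
      using that by (auto simp: S_def)
    have prime: "prime_elem p"
      using that pr prime_imp_prime_elem unfolding S_def by blast
    then have "p dvd A * y ^ k" using assms(1) p(1) by simp
    then have "p dvd y" using p prime by (metis prime_elem_dvd_mult_iff prime_elem_dvd_power)
    then have "p\<^sup>2 dvd y ^ k" using assms(3) by (meson dvd_trans dvd_power_same le_imp_power_dvd)
    then have "p\<^sup>2 dvd u * v" using assms(1) by (metis dvd_mult)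
    moreover have "coprime (p\<^sup>2) v" using p(1) assms(2) by (metis coprime_divisors coprime_power_left_iff dvd_refl)
    ultimately show ?thesis by (metis coprime_dvd_mult_left_iff)
  qed
  have "(\<Prod>p\<in>T. p\<^sup>2) dvd u" if "T \<subseteq> S" "finite T" for T
    using that(2,1)
  proof induction
    case (insert p T)
    have "coprime (p\<^sup>2) (\<Prod>q\<in>T. q\<^sup>2)"
      using insert by (intro prod_coprime_right) (auto simp: S_def subset_iff intro!: primes_coprime pr)
    then show ?case using insert sq by (simp add: divides_mult)
  qed simp
  then have "(\<Prod>S)\<^sup>2 dvd u" using fin by (simp add: prod_power_distrib)
  moreover have "\<Prod>S > 0" by (rule prod_pos) (auto simp: S_def intro!: prime_gt_0_int pr)
  moreover have "p dvd A * \<Prod>S" if "p \<in> prime_factors u" for p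
  proof (cases "p dvd A")
    case False
    then have "p \<in> S" using that by (simp add: S_def)
    then show ?thesis using fin dvd_prodI[of S p "\<lambda>x. x"] by simp
  qed simp
  ultimately show ?thesis using that by blast
qed

section \<open>Real quadratic fields\<close>

lemma algebraic_int_quadratic:
  fixes x :: "'a :: field_char_0"
  assumes "x\<^sup>2 = of_int p * x + of_int q"
  shows "algebraic_int x"
proof (rule algebraic_int.intros)
  show "Polynomial.lead_coeff [:- of_int q, - of_int p, 1 :: 'a:] = 1" by simp
  show "\<forall>i. Polynomial.coeff [:- of_int q, - of_int p, 1 :: 'a:] i \<in> \<int>"
    by (auto simp: coeff_pCons split: nat.split)
  show "poly [:- of_int q, - of_int p, 1:] x = 0"
    using assms by (simp add: algebra_simps power2_eq_square)
qed

text \<open>The setting of a real quadratic field \<open>K\<close>. The integer \<open>D\<close> need not be squarefree, so \<open>\<int>[\<surd>D]\<close> may be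
  smaller than the ring of integers.\<close>

locale real_quadratic =
  fixes D :: int
  assumes D_pos: "D > 0" and sqrt_D_irrational: "sqrt (of_int D) \<notin> \<rat>"
begin

abbreviation K :: "real set" where "K \<equiv> quadratic_field D"

abbreviation s :: real where "s \<equiv> sqrt (of_int D)"

lemma s_square: "s * s = of_int D"
  using D_pos by simp

lemma s_pos: "s > 0"
  using D_pos by simp

lemma K_cases:
  assumes "x \<in> K"
  obtains a b where "x = of_rat a + of_rat b * s"
  using assms by (auto simp: quadratic_field_def)

lemma K_memI: "of_rat a + of_rat b * s \<in> K"
  by (auto simp: quadratic_field_def)

lemma of_rat_in_K: "of_rat a \<in> K"
  using K_memI[of a 0] by simp

lemma of_int_in_K: "of_int a \<in> K"
  using of_rat_in_K[of "of_int a"] by simp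

lemma s_in_K: "s \<in> K"
  using K_memI[of 0 1] by simp

lemma K_add: "x \<in> K \<Longrightarrow> y \<in> K \<Longrightarrow> x + y \<in> K"
proof (elim K_cases)
  fix a b c d assume "x = of_rat a + of_rat b * s" "y = of_rat c + of_rat d * s"
  then have "x + y = of_rat (a + c) + of_rat (b + d) * s"
    by (simp add: of_rat_add algebra_simps)
  then show ?thesis using K_memI by simp
qed

lemma K_mult: "x \<in> K \<Longrightarrow> y \<in> K \<Longrightarrow> x * y \<in> K"
proof (elim K_cases)
  fix a b c d assume "x = of_rat a + of_rat b * s" "y = of_rat c + of_rat d * s"
  then have "x * y = of_rat a * of_rat c + of_rat b * of_rat d * (s * s) + (of_rat a * of_rat d + of_rat b * of_rat c) * s"
    by (simp add: algebra_simps)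
  also have "\<dots> = of_rat (a * c + b * d * of_int D) + of_rat (a * d + b * c) * s"
    unfolding s_square by (simp add: of_rat_add of_rat_mult)
  finally show ?thesis using K_memI by metis
qed

lemma K_minus: "x \<in> K \<Longrightarrow> - x \<in> K"
  using K_mult[OF of_int_in_K[of "-1"]] by simp

lemma K_power: "x \<in> K \<Longrightarrow> x ^ n \<in> K"
  by (induction n) (use of_int_in_K[of 1] in \<open>auto intro: K_mult\<close>)

lemma coords_zero:
  assumes "of_rat a + of_rat b * s = (0 :: real)"
  shows "a = 0" "b = 0"
proof -
  show "b = 0"
  proof (rule ccontr)
    assume "b \<noteq> 0"
    then have "s = of_rat (- a / b)"
      using assms by (simp add: of_rat_divide of_rat_minus field_simps)
    then show False using sqrt_D_irrational by (metis Rats_of_rat)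
  qed
  then show "a = 0" using assms by simp
qed

lemma coords_unique:
  assumes "of_rat a + of_rat b * s = (of_rat c + of_rat d * s :: real)"
  shows "a = c" "b = d"
  using coords_zero[of "a - c" "b - d"] assms by (auto simp: of_rat_diff algebra_simps)

subsection \<open>Conjugation\<close>

text \<open>The nontrivial automorphism of \<open>K\<close>; it is only used on \<open>K\<close>, where the coordinates
  exist and are unique.\<close>

definition conj :: "real \<Rightarrow> real" where
  "conj x = (THE y. \<exists>a b. x = of_rat a + of_rat b * s \<and> y = of_rat a - of_rat b * s)"

lemma conj_eq [simp]: "conj (of_rat a + of_rat b * s) = of_rat a - of_rat b * s"
  unfolding conj_def by (rule the_equality) (use coords_unique in blast)+

lemma conj_of_rat [simp]: "conj (of_rat a) = of_rat a"
  using conj_eq[of a 0] by simp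

lemma conj_of_int [simp]: "conj (of_int a) = of_int a"
  using conj_of_rat[of "of_int a"] by simp

lemma conj_s [simp]: "conj s = - s"
  using conj_eq[of 0 1] by simp

lemma conj_in_K: "x \<in> K \<Longrightarrow> conj x \<in> K"
proof (elim K_cases)
  fix a b assume "x = of_rat a + of_rat b * s"
  then have "conj x = of_rat a + of_rat (- b) * s" by (simp add: of_rat_minus)
  then show ?thesis using K_memI by simp
qed

lemma conj_add: "x \<in> K \<Longrightarrow> y \<in> K \<Longrightarrow> conj (x + y) = conj x + conj y"
proof (elim K_cases)
  fix a b c d assume xy: "x = of_rat a + of_rat b * s" "y = of_rat c + of_rat d * s"
  then have "x + y = of_rat (a + c) + of_rat (b + d) * s"
    by (simp add: of_rat_add algebra_simps)
  then show ?thesis by (simp only: conj_eq xy) (simp add: of_rat_add algebra_simps)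
qed

lemma conj_mult: "x \<in> K \<Longrightarrow> y \<in> K \<Longrightarrow> conj (x * y) = conj x * conj y"
proof (elim K_cases)
  fix a b c d assume xy: "x = of_rat a + of_rat b * s" "y = of_rat c + of_rat d * s"
  then have "x * y = of_rat a * of_rat c + of_rat b * of_rat d * (s * s) + (of_rat a * of_rat d + of_rat b * of_rat c) * s"
    by (simp add: algebra_simps)
  also have "\<dots> = of_rat (a * c + b * d * of_int D) + of_rat (a * d + b * c) * s"
    unfolding s_square by (simp add: of_rat_add of_rat_mult)
  finally have "conj (x * y) = of_rat (a * c + b * d * of_int D) - of_rat (a * d + b * c) * s"
    by (simp only: conj_eq)
  also have "\<dots> = of_rat a * of_rat c + of_rat b * of_rat d * (s * s) - (of_rat a * of_rat d + of_rat b * of_rat c) * s"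
    unfolding s_square by (simp add: of_rat_add of_rat_mult)
  also have "\<dots> = conj x * conj y"
    unfolding xy conj_eq by (simp add: algebra_simps)
  finally show ?thesis .
qed

lemma conj_power: "x \<in> K \<Longrightarrow> conj (x ^ n) = conj x ^ n"
  by (induction n) (use conj_of_int[of 1] in \<open>simp_all add: conj_mult K_power\<close>)

lemma conj_minus: "x \<in> K \<Longrightarrow> conj (- x) = - conj x"
  using conj_mult[OF of_int_in_K[of "-1"], of x] conj_of_int[of "-1"] by simp

lemma norm_rational: "x \<in> K \<Longrightarrow> x * conj x \<in> \<rat>"
proof (elim K_cases)
  fix a b assume x: "x = of_rat a + of_rat b * s"
  have "x * conj x = of_rat a * of_rat a - of_rat b * of_rat b * (s * s)"
    unfolding x conj_eq by (simp add: algebra_simps)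
  then show ?thesis unfolding s_square by simp
qed

lemma conj_nonzero:
  assumes "x \<in> K" "x \<noteq> 0"
  shows "conj x \<noteq> 0"
  using assms(1)
proof (rule K_cases)
  fix a b assume x: "x = of_rat a + of_rat b * s"
  show ?thesis
  proof
    assume "conj x = 0"
    then have "of_rat a + of_rat (- b) * s = (0 :: real)" using x by (simp add: of_rat_minus)
    from coords_zero[OF this] x assms(2) show False by simp
  qed
qed

text \<open>A conjugate is a root of the same integral polynomial.\<close>

lemma algebraic_int_conj:
  assumes "x \<in> K" "algebraic_int x"
  shows "algebraic_int (conj x)"
proof -
  obtain p :: "int poly" where p: "poly (map_poly of_int p) x = 0" "Polynomial.lead_coeff p = 1"
    using assms(2) algebraic_int_altdef_ipoly by blast
  have "poly (map_poly of_int q) x \<in> K \<and> conj (poly (map_poly of_int q) x) = poly (map_poly of_int q) (conj x)"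
    for q :: "int poly"
  proof (induction q)
    case 0
    then show ?case using of_int_in_K[of 0] conj_of_int[of 0] by simp
  next
    case (pCons c q)
    then show ?case
      by (auto simp: map_poly_pCons conj_add conj_mult K_add K_mult of_int_in_K assms(1))
  qed
  then have "poly (map_poly of_int p) (conj x) = 0"
    using p(1) conj_of_int[of 0] by (metis of_int_0)
  then show ?thesis using p(2) algebraic_int_altdef_ipoly by blast
qed

subsection \<open>Degree and real embeddings\<close>

text \<open>The degree only occurs as a common factor of height and radical, so it suffices that it does
  not vanish.\<close>

lemma field_degree_pos: "field_degree K > 0"
proof -
  interpret V: vector_space "\<lambda>(q :: rat) (x :: real). of_rat q * x"
    by unfold_locales (simp_all add: algebra_simps of_rat_add of_rat_mult)
  have "K \<subseteq> V.span {1, s}"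
  proof
    fix x assume "x \<in> K"
    then obtain a b where "x = of_rat a + of_rat b * s" by (rule K_cases)
    moreover have "of_rat a * 1 + of_rat b * s \<in> V.span {1, s}"
      by (intro V.span_add V.span_scale V.span_base) auto
    ultimately show "x \<in> V.span {1, s}" by simp
  qed
  then obtain B where B: "B \<subseteq> K" "V.independent B" "K \<subseteq> V.span B" "card B = V.dim K"
    using V.basis_exists by blast
  have "finite B"
    by (rule V.independent_span_bound[THEN conjunct1, of "{1, s}"])
       (use B \<open>K \<subseteq> V.span {1, s}\<close> in auto)
  moreover have "B \<noteq> {}" using B(3) of_int_in_K[of 1] by auto
  ultimately have "V.dim K > 0" using B(4) by (metis card_gt_0_iff)
  then show ?thesis by (simp add: field_degree_def)
qed

lemma real_embeddings_eq: "real_embeddings K = {restrict (\<lambda>x. x) K, restrict conj K}"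
proof (intro equalityI subsetI)
  fix \<sigma> assume "\<sigma> \<in> {restrict (\<lambda>x. x) K, restrict conj K}"
  then show "\<sigma> \<in> real_embeddings K"
    using of_int_in_K[of 1] conj_of_int[of 1]
    by (auto simp: real_embeddings_def ring_hom_def real_subring_def K_add K_mult conj_add conj_mult)
next
  fix \<sigma> assume \<sigma>: "\<sigma> \<in> real_embeddings K"
  then have add: "\<sigma> (x + y) = \<sigma> x + \<sigma> y" and mult: "\<sigma> (x * y) = \<sigma> x * \<sigma> y"
    if "x \<in> K" "y \<in> K" for x y
    using that by (auto simp: real_embeddings_def ring_hom_def real_subring_def)
  have one: "\<sigma> 1 = 1" and ext: "\<sigma> \<in> extensional K"
    using \<sigma> by (auto simp: real_embeddings_def ring_hom_def real_subring_def)
  have zero: "\<sigma> 0 = 0" using add[of 0 0] of_int_in_K[of 0] by simp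
  have nat: "\<sigma> (of_nat n) = of_nat n" for n
  proof (induction n)
    case (Suc n)
    then show ?case using add[of 1 "of_nat n"] of_int_in_K[of 1] of_int_in_K[of "int n"] one by simp
  qed (simp add: zero)
  have int: "\<sigma> (of_int z) = of_int z" for z
  proof (cases z rule: int_cases2)
    case (nonpos n)
    then show ?thesis
      using add[of "of_nat n" "- of_nat n"] of_int_in_K[of "int n"] of_int_in_K[of "- int n"] nat[of n] zero
      by simp
  qed (simp add: nat)
  have rat: "\<sigma> (of_rat q) = of_rat q" for q
  proof (cases q)
    case (Fract a b)
    have q: "of_rat q * of_int b = (of_int a :: real)"
      using Fract by (simp add: of_rat_rat)
    then have "\<sigma> (of_rat q) * of_int b = of_int a"
      using mult[OF of_rat_in_K of_int_in_K, of q b] int by simp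
    also have "\<dots> = of_rat q * of_int b" using q by simp
    finally show ?thesis using Fract by simp
  qed
  have "\<sigma> s * \<sigma> s = s * s"
    using mult[OF s_in_K s_in_K] int[of D] s_square by simp
  then have "(\<sigma> s - s) * (\<sigma> s + s) = 0" by (simp add: algebra_simps)
  then consider "\<sigma> s = s" | "\<sigma> s = - s" by (auto simp: add_eq_0_iff)
  then show "\<sigma> \<in> {restrict (\<lambda>x. x) K, restrict conj K}"
  proof cases
    case 1
    have "\<sigma> x = x" if "x \<in> K" for x
      using that by (rule K_cases) (simp add: add mult K_mult of_rat_in_K s_in_K rat 1)
    then have "\<sigma> = restrict (\<lambda>x. x) K" using ext by (auto simp: extensional_def restrict_def)
    then show ?thesis by simp
  next
    case 2
    have "\<sigma> x = conj x" if "x \<in> K" for x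
      using that by (rule K_cases) (simp add: add mult K_mult of_rat_in_K s_in_K rat 2)
    then have "\<sigma> = restrict conj K" using ext by (auto simp: extensional_def restrict_def)
    then show ?thesis by simp
  qed
qed

lemma real_embeddings_distinct: "restrict (\<lambda>x. x) K \<noteq> restrict conj K"
proof
  assume "restrict (\<lambda>x. x) K = restrict conj K"
  then have "s = conj s" by (metis restrict_apply' s_in_K)
  then show False using s_pos by simp
qed

lemma sum_real_embeddings:
   "(\<Sum>\<sigma>\<in>real_embeddings K. f \<sigma>) = f (restrict (\<lambda>x. x) K) + f (restrict conj K)"
  using real_embeddings_distinct by (simp add: real_embeddings_eq)

section \<open>The integers of \<open>K\<close> and their prime ideals\<close>

abbreviation places :: "real set set" where "places \<equiv> finite_places K"

text \<open>The carrier of the ring of integers. That it is closed under addition and multiplication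
  is only needed below in the presence of a prime ideal, and there it is part of the
  hypothesis that the integers form a ring.\<close>

definition integers :: "real set" where
  "integers = {x \<in> K. algebraic_int x}"

lemma integers_simps:
  "carrier (ring_of_integers K) = integers" "x \<otimes>\<^bsub>ring_of_integers K\<^esub> y = x * y"
  "x \<oplus>\<^bsub>ring_of_integers K\<^esub> y = x + y" "\<one>\<^bsub>ring_of_integers K\<^esub> = 1" "\<zero>\<^bsub>ring_of_integers K\<^esub> = 0"
  by (simp_all add: integers_def ring_of_integers_def real_subring_def)

lemma integers_in_K: "x \<in> integers \<Longrightarrow> x \<in> K"
  by (simp add: integers_def)

lemma of_int_in_integers: "of_int m \<in> integers"
  by (simp add: integers_def of_int_in_K)

lemma one_in_integers: "1 \<in> integers"
  using of_int_in_integers[of 1] by simp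

lemma s_in_integers: "s \<in> integers"
  by (auto simp: integers_def s_in_K)

lemma conj_in_integers: "x \<in> integers \<Longrightarrow> conj x \<in> integers"
  by (simp add: integers_def conj_in_K algebraic_int_conj)

lemma rational_integer: "x \<in> integers \<Longrightarrow> x \<in> \<rat> \<Longrightarrow> x \<in> \<int>"
  by (simp add: integers_def rational_algebraic_int_is_int)

lemma place_cring: "\<pp> \<in> places \<Longrightarrow> cring (ring_of_integers K)"
  by (auto simp: finite_places_def primeideal_def)

lemma place_ideal: "\<pp> \<in> places \<Longrightarrow> ideal \<pp> (ring_of_integers K)"
  by (auto simp: finite_places_def primeideal_def)

lemma integers_closed:
  assumes "\<pp> \<in> places" "x \<in> integers" "y \<in> integers"
  shows "x + y \<in> integers" "x * y \<in> integers" "x - y \<in> integers"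
proof -
  interpret cring "ring_of_integers K" using assms(1) by (rule place_cring)
  have *: "x + y \<in> integers" if "x \<in> integers" "y \<in> integers" for x y
    using a_closed[of x y] that by (simp add: integers_simps)
  then show "x + y \<in> integers" using assms(2,3) .
  show "x * y \<in> integers"
    using m_closed[of x y] assms(2,3) by (simp add: integers_simps)
  have "- y \<in> integers" using assms(3) by (simp add: integers_def K_minus)
  then show "x - y \<in> integers" using *[of x "- y"] assms(2) by simp
qed

lemma integers_power:
  "\<pp> \<in> places \<Longrightarrow> x \<in> integers \<Longrightarrow> x ^ n \<in> integers"
  by (induction n) (auto intro: integers_closed one_in_integers)

lemma ideal_closed:
  assumes "ideal I (ring_of_integers K)"
  shows "I \<subseteq> integers" "0 \<in> I" "x \<in> I \<Longrightarrow> y \<in> I \<Longrightarrow> x + y \<in> I"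
    "x \<in> I \<Longrightarrow> r \<in> integers \<Longrightarrow> r * x \<in> I" "x \<in> I \<Longrightarrow> r \<in> integers \<Longrightarrow> x * r \<in> I"
    "x \<in> I \<Longrightarrow> - x \<in> I" "x \<in> I \<Longrightarrow> y \<in> I \<Longrightarrow> x - y \<in> I"
proof -
  interpret ideal I "ring_of_integers K" by fact
  show "I \<subseteq> integers" using a_subset by (simp add: integers_simps)
  show "0 \<in> I"
    using additive_subgroup.zero_closed[OF ideal.axioms(1)[OF assms]] by (simp add: integers_simps)
  show add: "x + y \<in> I" if "x \<in> I" "y \<in> I" for x y
    
    using additive_subgroup.a_closed[OF ideal.axioms(1)[OF assms], of x y] that by (simp add: integers_simps)
  show mult: "r * x \<in> I" if "x \<in> I" "r \<in> integers" for r x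
    using I_l_closed[of x r] that by (simp add: integers_simps)
  show "x * r \<in> I" if "x \<in> I" "r \<in> integers" using mult[OF that] by (simp add: mult.commute)
  have neg: "- x \<in> I" if "x \<in> I" for x
    using mult[OF that of_int_in_integers[of "-1"]] by simp
  show "- x \<in> I" if "x \<in> I" using neg[OF that] .
  show "x - y \<in> I" if "x \<in> I" "y \<in> I"
    using add[of x "- y"] neg[of y] that by simp
qed

lemmas place_closed = ideal_closed[OF place_ideal]

lemma place_prime:
  assumes "\<pp> \<in> places" "x \<in> integers" "y \<in> integers" "x * y \<in> \<pp>"
  shows "x \<in> \<pp> \<or> y \<in> \<pp>"
proof -
  interpret primeideal \<pp> "ring_of_integers K" using assms(1) by (auto simp: finite_places_def)
  show ?thesis using I_prime[of x y] assms by (simp add: integers_simps)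
qed

lemma place_one:
  assumes "\<pp> \<in> places"
  shows "1 \<notin> \<pp>"
proof
  assume 1: "1 \<in> \<pp>"
  interpret primeideal \<pp> "ring_of_integers K" using assms by (auto simp: finite_places_def)
  have "integers \<subseteq> \<pp>" using place_closed(4)[OF assms 1] by auto
  then show False using I_notcarr place_closed(1)[OF assms] by (auto simp: integers_simps)
qed

lemma place_prime_power:
  assumes "\<pp> \<in> places" "x \<in> integers" "x ^ n \<in> \<pp>"
  shows "x \<in> \<pp>"
  using assms(3)
proof (induction n)
  case 0
  then show ?case using place_one[OF assms(1)] by simp
next
  case (Suc n)
  then show ?case using place_prime[OF assms(1,2) integers_power[OF assms(1,2)], of n] by auto
qed

subsection \<open>Residues\<close>

lemma place_contains_int:
  assumes "\<pp> \<in> places"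
  obtains m :: int where "m > 0" "of_int m \<in> \<pp>"
proof -
  have "\<pp> \<noteq> {0}" "0 \<in> \<pp>" using assms place_closed(2) by (auto simp: finite_places_def)
  then obtain x where x: "x \<in> \<pp>" "x \<noteq> 0" by blast
  have xO: "x \<in> integers" using x place_closed(1)[OF assms] by blast
  have xc: "x * conj x \<in> \<pp>" using x xO assms by (simp add: place_closed(5) conj_in_integers)
  moreover have "x * conj x \<in> \<int>"
    using xc place_closed(1)[OF assms] xO norm_rational integers_in_K rational_integer by blast
  ultimately obtain z where z: "x * conj x = of_int z" by (auto elim: Ints_cases)
  have "z \<noteq> 0" using z x conj_nonzero[OF integers_in_K[OF xO]] by auto
  have "of_int \<bar>z\<bar> \<in> \<pp>" using xc z place_closed(6)[OF assms] by (cases "z \<ge> 0") auto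
  then show ?thesis using \<open>z \<noteq> 0\<close> by (intro that[of "\<bar>z\<bar>"]) auto
qed

text \<open>An integral basis \<open>1, \<omega>\<close>. For \<open>x = a + b \<surd>D\<close> the number \<open>(x - conj x) \<surd>D = 2 b D\<close> is a rational
  algebraic integer, hence an integer, and \<open>\<omega>\<close> is an element for which it is positive and minimal.\<close>

lemma integral_basis:
  assumes "\<pp> \<in> places"
  obtains \<omega> where "\<omega> \<in> integers" "\<And>x. x \<in> integers \<Longrightarrow> \<exists>i j. x = of_int i + of_int j * \<omega>"
proof -
  define g where "g x = (x - conj x) * s" for x
  note closed = integers_closed[OF assms]
  have g_coords: "g (of_rat a + of_rat b * s) = of_rat (2 * b * of_int D)" for a b
  proof -
    have "g (of_rat a + of_rat b * s) = 2 * of_rat b * (s * s)"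
      unfolding g_def conj_eq by (simp add: algebra_simps)
    then show ?thesis unfolding s_square by (simp add: of_rat_mult)
  qed
  have g_int: "g x \<in> \<int>" if "x \<in> integers" for x
  proof (rule rational_integer)
    show "g x \<in> integers"
      unfolding g_def using that by (intro closed conj_in_integers s_in_integers)
    show "g x \<in> \<rat>" using integers_in_K[OF that] by (rule K_cases) (simp add: g_coords)
  qed
  have g_lin: "g (x - of_int k * y) = g x - of_int k * g y" if "x \<in> integers" "y \<in> integers" for x y k
  proof -
    have "conj (x + of_int (- k) * y) = conj x + of_int (- k) * conj y"
      using that conj_of_int[of "- k"] of_int_in_K[of "- k"]
      by (simp only: conj_add conj_mult K_mult integers_in_K)
    then have "conj (x - of_int k * y) = conj x - of_int k * conj y" by simp
    then show ?thesis unfolding g_def by (simp only: left_diff_distrib right_diff_distrib mult.assoc)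
  qed
  \<comment> \<open>The values of \<open>g\<close> form a subgroup of \<open>\<int>\<close>, nonzero because \<open>g \<surd>D = 2 D\<close>.\<close>
  define M where "M = {n :: nat. n > 0 \<and> (\<exists>x\<in>integers. g x = of_nat n)}"
  have "nat (2 * D) \<in> M"
    unfolding M_def using s_in_integers D_pos g_coords[of 0 1] by (auto simp: of_rat_mult intro!: bexI[of _ s])
  define n0 where "n0 = (LEAST n. n \<in> M)"
  have n0: "n0 \<in> M" unfolding n0_def using \<open>nat (2 * D) \<in> M\<close> by (rule LeastI)
  then obtain \<omega> where \<omega>: "\<omega> \<in> integers" "g \<omega> = of_nat n0" "n0 > 0" by (auto simp: M_def)
  have "\<exists>i j. x = of_int i + of_int j * \<omega>" if x: "x \<in> integers" for x
  proof -
    obtain z where z: "g x = of_int z" using g_int[OF x] by (auto elim: Ints_cases)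
    define y where "y = x - of_int (z div int n0) * \<omega>"
    have y: "y \<in> integers" unfolding y_def using x \<omega>(1) by (intro closed of_int_in_integers)
    have gy: "g y = of_int (z mod int n0)"
    proof -
      have "g y = of_int (z - z div int n0 * int n0)"
        unfolding y_def g_lin[OF x \<omega>(1)] z \<omega>(2) by (simp only: of_int_diff of_int_mult of_int_of_nat_eq)
      then show ?thesis by (simp only: minus_div_mult_eq_mod)
    qed
    have "z mod int n0 = 0"
    proof (rule ccontr)
      assume "z mod int n0 \<noteq> 0"
      moreover have "z mod int n0 \<ge> 0" using \<omega>(3) by simp
      ultimately have pos: "z mod int n0 > 0" by linarith
      then have "g y = of_nat (nat (z mod int n0))" using gy by simp
      then have "nat (z mod int n0) \<in> M" unfolding M_def using y pos by auto
      then have "n0 \<le> nat (z mod int n0)" unfolding n0_def by (rule Least_le)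
      moreover have "z mod int n0 < int n0" using \<omega>(3) by simp
      ultimately show False using pos by linarith
    qed
    have "y \<in> \<rat>"
      using integers_in_K[OF y]
    proof (rule K_cases)
      fix a b assume ab: "y = of_rat a + of_rat b * s"
      then have "of_rat (2 * b * of_int D) = (0 :: real)"
        using gy \<open>z mod int n0 = 0\<close> g_coords[of a b] by simp
      then have "b = 0" using D_pos by simp
      then show ?thesis using ab by simp
    qed
    then obtain i where "y = of_int i" using rational_integer[OF y] by (auto elim: Ints_cases)
    then have "x = of_int i + of_int (z div int n0) * \<omega>" by (simp add: y_def)
    then show ?thesis by blast
  qed
  then show ?thesis using that \<omega>(1) by blast
qed

text \<open>Reducing both coordinates modulo \<open>m\<close> gives at most \<open>m\<^sup>2\<close> residues for all ideals that
  contain \<open>m\<close> at once.\<close>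

lemma residue_system:
  assumes "\<pp> \<in> places" "m > 0"
  obtains R where "finite R" "card R \<le> (nat m)\<^sup>2"
    "\<And>x. x \<in> integers \<Longrightarrow> \<exists>r\<in>R. \<forall>I\<in>places. of_int m \<in> I \<longrightarrow> x - r \<in> I"
proof -
  obtain \<omega> where \<omega>: "\<omega> \<in> integers" and basis: "\<And>x. x \<in> integers \<Longrightarrow> \<exists>i j. x = of_int i + of_int j * \<omega>"
    using integral_basis[OF assms(1)] by blast
  note closed = integers_closed[OF assms(1)]
  define R where "R = (\<lambda>(i, j). of_int i + of_int j * \<omega>) ` ({0..<m} \<times> {0..<m})"
  show ?thesis
  proof (rule that)
    show "finite R" by (simp add: R_def)
    have "card R \<le> card ({0..<m} \<times> {0..<m})" unfolding R_def by (intro card_image_le) simp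
    then show "card R \<le> (nat m)\<^sup>2" by (simp add: power2_eq_square)
    fix x assume "x \<in> integers"
    then obtain i j where x: "x = of_int i + of_int j * \<omega>" using basis by blast
    \<comment> \<open>The difference of \<open>x\<close> and its reduction is an integer multiple of \<open>m\<close>.\<close>
    have coord: "of_int k = (of_int (k div m) * of_int m + of_int (k mod m) :: real)" for k
      by (metis div_mult_mod_eq of_int_add of_int_mult)
    have "x - (of_int (i mod m) + of_int (j mod m) * \<omega>) \<in> I" if I: "I \<in> places" "of_int m \<in> I" for I
    proof -
      have "x - (of_int (i mod m) + of_int (j mod m) * \<omega>)
          = (of_int (i div m) + of_int (j div m) * \<omega>) * of_int m"
        unfolding x by (subst coord[of i], subst coord[of j]) (simp add: algebra_simps)
      moreover have "of_int (i div m) + of_int (j div m) * \<omega> \<in> integers"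
        using \<omega> by (intro closed of_int_in_integers)
      ultimately show ?thesis using place_closed(4)[OF I] by metis
    qed
    moreover have "of_int (i mod m) + of_int (j mod m) * \<omega> \<in> R"
      unfolding R_def using assms(2) by (auto intro!: image_eqI[of _ _ "(i mod m, j mod m)"])
    ultimately show "\<exists>r\<in>R. \<forall>I\<in>places. of_int m \<in> I \<longrightarrow> x - r \<in> I" by blast
  qed
qed

text \<open>The coset \<open>\<pp> + x\<close>.\<close>

definition residue_class :: "real set \<Rightarrow> real \<Rightarrow> real set" where
  "residue_class \<pp> x = (\<lambda>h. h + x) ` \<pp>"

lemma residue_class_eq_iff:
  assumes "\<pp> \<in> places"
  shows "residue_class \<pp> x = residue_class \<pp> y \<longleftrightarrow> x - y \<in> \<pp>"
proof
  assume "residue_class \<pp> x = residue_class \<pp> y"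
  moreover have "x \<in> residue_class \<pp> x"
    unfolding residue_class_def using place_closed(2)[OF assms] by force
  ultimately obtain h where "h \<in> \<pp>" "x = h + y" by (auto simp: residue_class_def)
  then show "x - y \<in> \<pp>" by simp
next
  have *: "residue_class \<pp> x \<subseteq> residue_class \<pp> y" if xy: "x - y \<in> \<pp>" for x y
  proof
    fix z assume "z \<in> residue_class \<pp> x"
    then obtain h where h: "h \<in> \<pp>" "z = h + x" by (auto simp: residue_class_def)
    then have "z = (h + (x - y)) + y" by simp
    moreover have "h + (x - y) \<in> \<pp>" using h xy place_closed(3)[OF assms] by blast
    ultimately show "z \<in> residue_class \<pp> y" unfolding residue_class_def by blast
  qed
  assume "x - y \<in> \<pp>"
  moreover from this have "y - x \<in> \<pp>" using place_closed(6)[OF assms, of "x - y"] by simp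
  ultimately show "residue_class \<pp> x = residue_class \<pp> y" using * by blast
qed

lemma ideal_norm_eq: "ideal_norm K \<pp> = card (residue_class \<pp> ` integers)"
proof -
  have "carrier (ring_of_integers K Quot \<pp>) = residue_class \<pp> ` integers"
    unfolding FactRing_def A_RCOSETS_defs r_coset_def residue_class_def
    by (auto simp: integers_simps)
  then show ?thesis by (simp add: ideal_norm_def)
qed

lemma finite_residue_classes:
  assumes "\<pp> \<in> places"
  shows "finite (residue_class \<pp> ` integers)"
proof -
  obtain m where m: "m > 0" "of_int m \<in> \<pp>" using place_contains_int[OF assms] .
  obtain R where R: "finite R" "\<And>x. x \<in> integers \<Longrightarrow> \<exists>r\<in>R. \<forall>I\<in>places. of_int m \<in> I \<longrightarrow> x - r \<in> I"
    using residue_system[OF assms m(1)] by metis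
  have "residue_class \<pp> ` integers \<subseteq> residue_class \<pp> ` R"
  proof
    fix c assume "c \<in> residue_class \<pp> ` integers"
    then obtain x where x: "x \<in> integers" "c = residue_class \<pp> x" by blast
    obtain r where "r \<in> R" "x - r \<in> \<pp>" using R(2)[OF x(1)] m(2) assms by blast
    then show "c \<in> residue_class \<pp> ` R" using x(2) residue_class_eq_iff[OF assms] by blast
  qed
  then show ?thesis using R(1) finite_surj by blast
qed

text \<open>The residue ring is a finite integral domain, so two powers of \<open>x\<close> agree and a
  power of \<open>x\<close> is the inverse.\<close>

lemma inverse_mod_place:
  assumes "\<pp> \<in> places" "x \<in> integers" "x \<notin> \<pp>"
  obtains y where "y \<in> integers" "1 - x * y \<in> \<pp>"
proof -
  note pow = integers_power[OF assms(1,2)]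
  have "\<not> inj (\<lambda>n :: nat. residue_class \<pp> (x ^ n))"
  proof
    assume "inj (\<lambda>n :: nat. residue_class \<pp> (x ^ n))"
    moreover have "finite (range (\<lambda>n :: nat. residue_class \<pp> (x ^ n)))"
      by (rule finite_subset[OF _ finite_residue_classes[OF assms(1)]]) (use pow in auto)
    ultimately show False using finite_imageD by blast
  qed
  then obtain i j where "i \<noteq> j" "residue_class \<pp> (x ^ i) = residue_class \<pp> (x ^ j)"
    by (auto simp: inj_def)
  then obtain i j where "i < j" "residue_class \<pp> (x ^ i) = residue_class \<pp> (x ^ j)"
    by (metis linorder_neqE_nat)
  moreover from this obtain d where "j = i + Suc d" by (metis add_Suc_right less_imp_Suc_add)
  ultimately have "x ^ i * (1 - x * x ^ d) \<in> \<pp>"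
    using residue_class_eq_iff[OF assms(1)] by (simp add: algebra_simps power_add)
  moreover have "1 - x * x ^ d \<in> integers"
    using integers_closed[OF assms(1)] pow[of d] assms(2) one_in_integers by blast
  ultimately have "1 - x * x ^ d \<in> \<pp>"
    using place_prime[OF assms(1) pow] place_prime_power[OF assms(1,2)] assms(3) by blast
  then show ?thesis using that pow by blast
qed

text \<open>Nonzero prime ideals are maximal, hence incomparable.\<close>

lemma places_not_subset:
  assumes "\<pp> \<in> places" "\<qq> \<in> places" "\<pp> \<noteq> \<qq>"
  shows "\<exists>x\<in>\<qq>. x \<notin> \<pp>"
proof (rule ccontr)
  assume "\<not> ?thesis"
  then have sub: "\<qq> \<subseteq> \<pp>" by blast
  then obtain x where x: "x \<in> \<pp>" "x \<notin> \<qq>" using assms(3) by blast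
  then have "x \<in> integers" using place_closed(1)[OF assms(1)] by blast
  then obtain y where y: "y \<in> integers" "1 - x * y \<in> \<qq>" using inverse_mod_place[OF assms(2)] x by blast
  then have "(1 - x * y) + x * y \<in> \<pp>"
    using sub x place_closed(3,5)[OF assms(1)] by blast
  then show False using place_one[OF assms(1)] by simp
qed

subsection \<open>The Chinese remainder theorem\<close>

lemma crt_idempotent:
  assumes "finite S" "S \<subseteq> places" "\<pp> \<in> places" "\<pp> \<notin> S"
  shows "\<exists>e\<in>integers. 1 - e \<in> \<pp> \<and> (\<forall>\<qq>\<in>S. e \<in> \<qq>)"
proof -
  have "\<exists>e\<in>integers. e \<notin> \<pp> \<and> (\<forall>\<qq>\<in>S. e \<in> \<qq>)"
    using assms(1,2,4)
  proof (induction S)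
    case empty
    then show ?case using one_in_integers place_one[OF assms(3)] by blast
  next
    case (insert \<qq> S)
    then obtain e where e: "e \<in> integers" "e \<notin> \<pp>" "\<forall>\<qq>\<in>S. e \<in> \<qq>" by auto
    obtain x where x: "x \<in> \<qq>" "x \<notin> \<pp>" using places_not_subset[of \<pp> \<qq>] insert.prems assms(3) by auto
    have xO: "x \<in> integers" using x insert.prems place_closed(1) by blast
    have "x * e \<in> integers" "x * e \<notin> \<pp>"
      using integers_closed(2)[OF assms(3)] place_prime[OF assms(3)] x e xO by blast+
    moreover have "x * e \<in> \<rr>" if "\<rr> \<in> insert \<qq> S" for \<rr>
      using that x e xO insert.prems place_closed(4,5)[of \<rr>] by auto
    ultimately show ?case by blast
  qed
  then obtain e where e: "e \<in> integers" "e \<notin> \<pp>" "\<forall>\<qq>\<in>S. e \<in> \<qq>" by blast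
  obtain y where y: "y \<in> integers" "1 - e * y \<in> \<pp>" using inverse_mod_place[OF assms(3) e(1,2)] .
  moreover have "e * y \<in> integers" using integers_closed(2)[OF assms(3)] e y by blast
  moreover have "\<forall>\<qq>\<in>S. e * y \<in> \<qq>" using e y place_closed(5) assms(2) by blast
  ultimately show ?thesis by blast
qed

lemma crt:
  assumes "finite S" "S \<subseteq> places" "\<And>\<pp>. \<pp> \<in> S \<Longrightarrow> t \<pp> \<in> integers"
  shows "\<exists>x\<in>integers. \<forall>\<pp>\<in>S. t \<pp> - x \<in> \<pp>"
  using assms
proof (induction S)
  case empty
  then show ?case using one_in_integers by blast
next
  case (insert \<qq> S)
  then obtain x where x: "x \<in> integers" "\<forall>\<pp>\<in>S. t \<pp> - x \<in> \<pp>" by auto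
  obtain e where e: "e \<in> integers" "1 - e \<in> \<qq>" "\<forall>\<pp>\<in>S. e \<in> \<pp>"
    using crt_idempotent[of S \<qq>] insert by auto
  have q: "\<qq> \<in> places" "t \<qq> \<in> integers" using insert.prems by auto
  \<comment> \<open>The correction leaves the residues at \<open>S\<close> alone and adjusts the one at \<open>\<qq>\<close>.\<close>
  define x' where "x' = x + (t \<qq> - x) * e"
  have tx: "t \<qq> - x \<in> integers" using integers_closed(3)[OF q(1)] q x by blast
  then have "x' \<in> integers" unfolding x'_def using integers_closed[OF q(1)] x e by blast
  moreover have "t \<pp> - x' \<in> \<pp>" if p: "\<pp> \<in> insert \<qq> S" for \<pp>
  proof (cases "\<pp> = \<qq>")
    case True
    have "t \<qq> - x' = (t \<qq> - x) * (1 - e)" by (simp add: x'_def algebra_simps)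
    then show ?thesis using place_closed(4)[OF q(1) e(2) tx] True by simp
  next
    case False
    then have "\<pp> \<in> S" "\<pp> \<in> places" using p insert.prems by auto
    then have "(t \<pp> - x) - (t \<qq> - x) * e \<in> \<pp>"
      using x e tx place_closed(4,7)[of \<pp>] by blast
    then show ?thesis by (simp add: x'_def algebra_simps)
  qed
  ultimately show ?case by blast
qed

text \<open>By the Chinese remainder theorem the integers modulo \<open>m\<close> map onto the product of the residue
  fields of the given primes.\<close>

lemma prod_ideal_norm_le:
  assumes "finite S" "S \<subseteq> places" "m > 0" "\<And>\<pp>. \<pp> \<in> S \<Longrightarrow> of_int m \<in> \<pp>"
  shows "(\<Prod>\<pp>\<in>S. ideal_norm K \<pp>) \<le> (nat m)\<^sup>2"
proof (cases "S = {}")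
  case True
  then show ?thesis using assms(3) by simp
next
  case False
  then obtain \<pp>0 where "\<pp>0 \<in> places" using assms(2) by blast
  then obtain R where R: "finite R" "card R \<le> (nat m)\<^sup>2"
    "\<And>x. x \<in> integers \<Longrightarrow> \<exists>r\<in>R. \<forall>I\<in>places. of_int m \<in> I \<longrightarrow> x - r \<in> I"
    using residue_system[OF _ assms(3)] by metis
  define F where "F r = (\<lambda>\<pp>\<in>S. residue_class \<pp> r)" for r
  have "PiE S (\<lambda>\<pp>. residue_class \<pp> ` integers) \<subseteq> F ` R"
  proof
    fix f assume f: "f \<in> PiE S (\<lambda>\<pp>. residue_class \<pp> ` integers)"
    then have "\<forall>\<pp>\<in>S. \<exists>t\<in>integers. f \<pp> = residue_class \<pp> t" by (auto simp: PiE_iff)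
    then obtain t where t: "\<And>\<pp>. \<pp> \<in> S \<Longrightarrow> t \<pp> \<in> integers" "\<And>\<pp>. \<pp> \<in> S \<Longrightarrow> f \<pp> = residue_class \<pp> (t \<pp>)"
      by metis
    obtain x where x: "x \<in> integers" "\<forall>\<pp>\<in>S. t \<pp> - x \<in> \<pp>" using crt[of S t] assms(1,2) t(1) by blast
    obtain r where r: "r \<in> R" "\<forall>I\<in>places. of_int m \<in> I \<longrightarrow> x - r \<in> I" using R(3)[OF x(1)] by blast
    have "f \<pp> = F r \<pp>" for \<pp>
    proof (cases "\<pp> \<in> S")
      case True
      then have "\<pp> \<in> places" using assms(2) by blast
      moreover from this have "residue_class \<pp> (t \<pp>) = residue_class \<pp> x"
        "residue_class \<pp> x = residue_class \<pp> r"
        using x(2) r(2) assms(4) True by (simp_all add: residue_class_eq_iff)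
      ultimately show ?thesis using True t(2) by (simp add: F_def)
    next
      case False
      then show ?thesis using f by (auto simp: F_def PiE_def extensional_def)
    qed
    then show "f \<in> F ` R" using r(1) by blast
  qed
  then have "card (PiE S (\<lambda>\<pp>. residue_class \<pp> ` integers)) \<le> card R"
    using R(1) by (rule surj_card_le[rotated])
  then show ?thesis using R(2) assms(1) by (simp add: card_PiE ideal_norm_eq)
qed

subsection \<open>Valuations\<close>

text \<open>An integer outside \<open>\<pp>\<close> is invertible modulo every power of \<open>\<pp>\<close>, so multiplication by
  it does not change the largest power that contains an element.\<close>

lemma mult_in_ideal_power_iff:
  assumes "\<pp> \<in> places" "x \<in> integers" "x \<notin> \<pp>" "b \<in> integers"
  shows "x * b \<in> \<pp> [^]\<^bsub>ideals_set (ring_of_integers K)\<^esub> (n :: nat)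
     \<longleftrightarrow> b \<in> \<pp> [^]\<^bsub>ideals_set (ring_of_integers K)\<^esub> n"
proof -
  interpret cring "ring_of_integers K" using assms(1) by (rule place_cring)
  interpret I: comm_monoid "ideals_set (ring_of_integers K)" by (rule ideals_set_is_comm_monoid)
  let ?p = "\<lambda>n :: nat. \<pp> [^]\<^bsub>ideals_set (ring_of_integers K)\<^esub> n"
  have "?p n \<in> carrier (ideals_set (ring_of_integers K))"
    using place_ideal[OF assms(1)] by (intro I.nat_pow_closed) (simp add: ideals_set_def)
  then have ideal: "ideal (?p n) (ring_of_integers K)" by (simp add: ideals_set_def)
  obtain y where y: "y \<in> integers" "1 - x * y \<in> \<pp>" using inverse_mod_place[OF assms(1-3)] .
  have power: "z ^ n \<in> ?p n" if "z \<in> \<pp>" for z and n :: nat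
  proof (induction n)
    case 0
    then show ?case by (simp add: ideals_set_def integers_simps one_in_integers)
  next
    case (Suc n)
    then show ?case using ideal_prod.prod[OF Suc that, of "ring_of_integers K"]
      by (simp add: ideals_set_def integers_simps mult.commute)
  qed
  \<comment> \<open>Expanding \<open>1 = (x y + (1 - x y))\<^sup>n\<close> shows that \<open>x\<close> is invertible modulo the \<open>n\<close>-th power.\<close>
  have "\<exists>w\<in>integers. 1 = x * w + (1 - x * y) ^ n" for n :: nat
  proof (induction n)
    case 0
    then show ?case using of_int_in_integers[of 0] by auto
  next
    case (Suc n)
    then obtain w where w: "w \<in> integers" "1 = x * w + (1 - x * y) ^ n" by blast
    have "1 = x * (w + y * (1 - x * y) ^ n) + (1 - x * y) ^ Suc n"
      by (subst w(2)) (simp add: algebra_simps)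
    moreover have "w + y * (1 - x * y) ^ n \<in> integers"
      using w y place_closed(1)[OF assms(1)]
      by (intro integers_closed[OF assms(1)] integers_power[OF assms(1)] assms(2) one_in_integers) auto
    ultimately show ?case by blast
  qed
  then obtain w where w: "w \<in> integers" "1 = x * w + (1 - x * y) ^ n" by blast
  have "b \<in> ?p n" if "x * b \<in> ?p n"
  proof -
    have "b = b * (x * w + (1 - x * y) ^ n)" using w(2) by simp
    also have "\<dots> = w * (x * b) + b * (1 - x * y) ^ n" by (simp add: algebra_simps)
    also have "\<dots> \<in> ?p n"
      using ideal_closed(4)[OF ideal that w(1)] ideal_closed(4)[OF ideal power[OF y(2)] assms(4)]
      by (rule ideal_closed(3)[OF ideal])
    finally show ?thesis .
  qed
  then show ?thesis using ideal_closed(4)[OF ideal _ assms(2)] by blast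
qed

lemma valuation_eq_0:
  assumes "\<pp> \<in> places" "x \<in> integers" "x \<notin> \<pp>"
  shows "valuation K \<pp> x = 0"
  unfolding valuation_def
proof (rule the_equality)
  have x0: "x \<noteq> 0" using assms(3) place_closed(2)[OF assms(1)] by auto
  have same: "integral_valuation K \<pp> (x * b) = integral_valuation K \<pp> b" if "b \<in> integers" for b
    unfolding integral_valuation_def using mult_in_ideal_power_iff[OF assms that] by simp
  show "\<exists>a\<in>carrier (ring_of_integers K) - {0}. \<exists>b\<in>carrier (ring_of_integers K) - {0}.
      x = a / b \<and> 0 = int (integral_valuation K \<pp> a) - int (integral_valuation K \<pp> b)"
    using assms(2) x0 one_in_integers same[of 1]
    by (intro bexI[of _ x] bexI[of _ 1]) (auto simp: integers_simps)
  fix m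
  assume "\<exists>a\<in>carrier (ring_of_integers K) - {0}. \<exists>b\<in>carrier (ring_of_integers K) - {0}.
      x = a / b \<and> m = int (integral_valuation K \<pp> a) - int (integral_valuation K \<pp> b)"
  then obtain a b where ab: "b \<in> integers" "b \<noteq> 0" "x = a / b"
    "m = int (integral_valuation K \<pp> a) - int (integral_valuation K \<pp> b)"
    by (auto simp: integers_simps)
  have "x * b = a" using ab(2,3) by simp
  then have "integral_valuation K \<pp> a = integral_valuation K \<pp> b"
    using same[OF ab(1)] by (simp only:)
  then show "m = 0" using ab(4) by simp
qed

lemma int_in_place_prime_factor:
  assumes "\<pp> \<in> places" "u \<noteq> 0" "of_int u \<in> \<pp>"
  shows "\<exists>p \<in> prime_factors u. of_int p \<in> \<pp>"
proof -
  have *: "of_int (prod_mset M) \<in> \<pp> \<Longrightarrow> \<exists>p \<in># M. of_int p \<in> \<pp>" for M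
  proof (induction M)
    case empty
    then show ?case using place_one[OF assms(1)] by simp
  next
    case (add p M)
    then show ?case
      using place_prime[OF assms(1) of_int_in_integers of_int_in_integers, of p "prod_mset M"] by auto
  qed
  have "of_int \<bar>u\<bar> \<in> \<pp>" using assms(3) place_closed(6)[OF assms(1)] by (cases "u \<ge> 0") auto
  then show ?thesis using *[of "prime_factorization u"] assms(2) by (simp add: prod_mset_prime_factorization)
qed

section \<open>Heights and radicals\<close>

text \<open>If \<open>a\<close> and \<open>b\<close> have valuation \<open>0\<close> everywhere, the finite places contribute nonnegative terms,
  so no summability is needed.\<close>

lemma abc_height_ge:
  assumes "a \<in> K" "b \<in> K" "a \<noteq> 0" "b \<noteq> 0"
    and "\<And>\<pp>. \<pp> \<in> places \<Longrightarrow> valuation K \<pp> a = 0" "\<And>\<pp>. \<pp> \<in> places \<Longrightarrow> valuation K \<pp> b = 0"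
    and "M > 0" "M \<le> max \<bar>a\<bar> \<bar>b\<bar>" "M \<le> max \<bar>conj a\<bar> \<bar>conj b\<bar>"
  shows "2 * ln M \<le> real (field_degree K) * abc_height K a b c"
proof -
  have "(\<Sum>\<^sub>\<infinity>\<pp>\<in>places. ln (Max {prime_abs K \<pp> a, prime_abs K \<pp> b, prime_abs K \<pp> c})) \<ge> 0"
  proof (rule infsum_nonneg)
    fix \<pp> assume "\<pp> \<in> places"
    then have "prime_abs K \<pp> a = 1" "prime_abs K \<pp> b = 1"
      using assms by (simp_all add: prime_abs_def)
    then have "1 \<le> Max {prime_abs K \<pp> a, prime_abs K \<pp> b, prime_abs K \<pp> c}"
      by (intro Max_ge) auto
    then show "ln (Max {prime_abs K \<pp> a, prime_abs K \<pp> b, prime_abs K \<pp> c}) \<ge> 0" by (rule ln_ge_zero)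
  qed
  moreover have place_le: "ln M \<le> ln (Max {\<bar>\<sigma> a\<bar>, \<bar>\<sigma> b\<bar>, \<bar>\<sigma> c\<bar>})" if "\<sigma> \<in> real_embeddings K" for \<sigma>
  proof (rule ln_mono)
    have "M \<le> max \<bar>\<sigma> a\<bar> \<bar>\<sigma> b\<bar>"
      using that assms(1,2,8,9) unfolding real_embeddings_eq by (elim insertE emptyE) simp_all
    also have "\<dots> \<le> Max {\<bar>\<sigma> a\<bar>, \<bar>\<sigma> b\<bar>, \<bar>\<sigma> c\<bar>}" by (intro max.boundedI Max_ge) simp_all
    finally show "M \<le> Max {\<bar>\<sigma> a\<bar>, \<bar>\<sigma> b\<bar>, \<bar>\<sigma> c\<bar>}" .
  qed fact
  then have "ln M + ln M \<le> (\<Sum>\<sigma>\<in>real_embeddings K. ln (Max {\<bar>\<sigma> a\<bar>, \<bar>\<sigma> b\<bar>, \<bar>\<sigma> c\<bar>}))"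
    unfolding sum_real_embeddings by (intro add_mono place_le) (simp_all only: real_embeddings_eq insert_iff simp_thms)
  ultimately show ?thesis using field_degree_pos by (simp add: abc_height_def)
qed

text \<open>An infinite support would make the sum in the radical \<open>0\<close>, so its finiteness need not be
  known.\<close>

lemma abc_radical_le:
  assumes "m > 0" "\<And>\<pp>. \<pp> \<in> abc_support K a b c \<Longrightarrow> of_int m \<in> \<pp>"
  shows "real (field_degree K) * abc_radical K a b c \<le> 2 * ln (of_int m)"
proof -
  let ?S = "abc_support K a b c"
  have "(\<Sum>\<pp>\<in>?S. ln (real (ideal_norm K \<pp>))) \<le> 2 * ln (of_int m)"
  proof (cases "finite ?S")
    case True
    have S: "?S \<subseteq> places" by (auto simp: abc_support_def)
    have pos: "ideal_norm K \<pp> > 0" if "\<pp> \<in> ?S" for \<pp>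
      using that S finite_residue_classes one_in_integers by (auto simp: ideal_norm_eq card_gt_0_iff)
    have "(\<Sum>\<pp>\<in>?S. ln (real (ideal_norm K \<pp>))) = ln (real (\<Prod>\<pp>\<in>?S. ideal_norm K \<pp>))"
      using pos True by (simp add: ln_prod)
    also have "\<dots> \<le> ln (real ((nat m)\<^sup>2))"
    proof (rule ln_mono)
      show "real (\<Prod>\<pp>\<in>?S. ideal_norm K \<pp>) \<le> real ((nat m)\<^sup>2)"
        using prod_ideal_norm_le[OF True S assms] of_nat_le_iff by blast
      show "0 < real (\<Prod>\<pp>\<in>?S. ideal_norm K \<pp>)" using pos by (simp add: prod_pos)
    qed
    also have "\<dots> = 2 * ln (of_int m)" using assms(1) by (simp add: ln_realpow)
    finally show ?thesis .
  qed (use assms(1) in simp)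
  then show ?thesis using field_degree_pos by (simp add: abc_radical_def)
qed

lemma valuation_unit_power:
  assumes "\<pp> \<in> places" "x \<in> integers" "y \<in> integers" "\<bar>x * y\<bar> = 1"
  shows "valuation K \<pp> (x ^ n) = 0" "valuation K \<pp> (- (x ^ n)) = 0"
proof -
  have "x \<notin> \<pp>"
  proof
    assume "x \<in> \<pp>"
    then have "x * y \<in> \<pp>" "- (x * y) \<in> \<pp>"
      using assms(3) place_closed(5,6)[OF assms(1)] by blast+
    then show False using assms(4) place_one[OF assms(1)] by (auto simp: abs_if split: if_splits)
  qed
  then have notin: "x ^ n \<notin> \<pp>" using place_prime_power[OF assms(1,2)] by blast
  then have "- (x ^ n) \<notin> \<pp>" using place_closed(6)[OF assms(1), of "- (x ^ n)"] by auto
  moreover have int: "x ^ n \<in> integers" using integers_power[OF assms(1,2)] .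
  moreover have "- (x ^ n) \<in> integers" using int by (simp add: integers_def K_minus)
  ultimately show "valuation K \<pp> (x ^ n) = 0" "valuation K \<pp> (- (x ^ n)) = 0"
    using notin valuation_eq_0[OF assms(1)] by blast+
qed

section \<open>The bound for one index\<close>

text \<open>The conjecture with \<open>\<epsilon> = 1/2\<close> is applied to \<open>\<alpha>\<^sup>n - \<beta>\<^sup>n = \<surd>D U\<^sub>n\<close>. With \<open>M = max \<bar>\<alpha>\<bar> \<bar>\<beta>\<bar> > 1\<close> the
  height is at least \<open>n ln M\<close>. Every prime ideal in the radical contains the integer \<open>D A r\<close>, and
  \<open>r\<^sup>2 \<le> \<bar>U\<^sub>n\<bar> \<le> 2 M\<^sup>n\<close>, so the radical is at most \<open>(n / 2) ln M\<close> up to a constant.\<close>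

lemma lucas_index_bounded:
  fixes P Q A :: int
  assumes "D = P\<^sup>2 + 4 * Q" "Q = 1 \<or> Q = - 1" "A \<noteq> 0" "abc_conjecture K"
  shows "\<exists>C. \<forall>n>0. lucas_U P Q n \<noteq> 0 \<and>
    (\<forall>r>0. r\<^sup>2 dvd lucas_U P Q n \<longrightarrow> (\<forall>p\<in>prime_factors (lucas_U P Q n). p dvd A * r) \<longrightarrow> real n < C)"
proof -
  define \<alpha> \<beta> where "\<alpha> = (of_int P + s) / 2" and "\<beta> = (of_int P - s) / 2"
  have D: "s * s = (of_int P)\<^sup>2 + 4 * of_int Q" using s_square assms(1) by simp
  have sum: "\<alpha> + \<beta> = of_int P" and diff: "\<alpha> - \<beta> = s" and prod: "\<alpha> * \<beta> = - of_int Q"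
    using D by (simp_all add: \<alpha>_def \<beta>_def field_simps power2_eq_square)
  have "\<alpha>\<^sup>2 = of_int P * \<alpha> + of_int Q" "\<beta>\<^sup>2 = of_int P * \<beta> + of_int Q"
    unfolding sum[symmetric] using prod by (simp_all add: algebra_simps power2_eq_square)
  then have alg: "algebraic_int \<alpha>" "algebraic_int \<beta>" using algebraic_int_quadratic by blast+
  have K: "\<alpha> \<in> K" "\<beta> \<in> K" and conj: "conj \<alpha> = \<beta>" "conj \<beta> = \<alpha>"
  proof -
    have \<alpha>: "\<alpha> = of_rat (of_int P / 2) + of_rat (1 / 2) * s"
      and \<beta>: "\<beta> = of_rat (of_int P / 2) + of_rat (- 1 / 2) * s"
      by (simp_all add: \<alpha>_def \<beta>_def of_rat_divide of_rat_minus field_simps)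
    show "\<alpha> \<in> K" "\<beta> \<in> K" using \<alpha> \<beta> K_memI by metis+
    show "conj \<alpha> = \<beta>" "conj \<beta> = \<alpha>"
      by (subst \<alpha>, subst conj_eq, simp add: \<beta>_def of_rat_divide field_simps)
         (subst \<beta>, subst conj_eq, simp add: \<alpha>_def of_rat_divide of_rat_minus field_simps)
  qed
  have integers: "\<alpha> \<in> integers" "\<beta> \<in> integers" using alg K by (simp_all add: integers_def)
  have unit: "\<bar>\<alpha> * \<beta>\<bar> = 1" "\<bar>\<beta> * \<alpha>\<bar> = 1" using prod assms(2) by (auto simp: mult.commute)
  have nz: "\<alpha> \<noteq> 0" "\<beta> \<noteq> 0" using unit by auto
  \<comment> \<open>For \<open>P = 0\<close> the only positive value of \<open>D\<close> is the square \<open>4\<close>; otherwise \<open>\<bar>\<alpha>\<bar>\<close> and \<open>\<bar>\<beta>\<bar>\<close> differ.\<close>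
  have "P \<noteq> 0"
  proof
    assume "P = 0"
    then have "D = 4" using D_pos assms(1,2) by auto
    then show False using sqrt_D_irrational by simp
  qed
  have abs_neq: "\<bar>\<alpha>\<bar> \<noteq> \<bar>\<beta>\<bar>"
    using sum diff s_pos \<open>P \<noteq> 0\<close> by (auto simp: abs_if split: if_splits)
  define M where "M = max \<bar>\<alpha>\<bar> \<bar>\<beta>\<bar>"
  have "M > 1"
  proof (rule ccontr)
    assume "\<not> M > 1"
    then have le: "\<bar>\<alpha>\<bar> \<le> 1" "\<bar>\<beta>\<bar> \<le> 1" by (auto simp: M_def)
    have "\<bar>\<alpha>\<bar> * \<bar>\<beta>\<bar> = 1" using unit by (simp add: abs_mult)
    then have "\<bar>\<alpha>\<bar> = 1" "\<bar>\<beta>\<bar> = 1"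
      using le mult_left_le[of "\<bar>\<beta>\<bar>" "\<bar>\<alpha>\<bar>"] mult_left_le[of "\<bar>\<alpha>\<bar>" "\<bar>\<beta>\<bar>"] by (simp_all add: mult.commute)
    then show False using abs_neq by simp
  qed
  define U where "U n = lucas_U P Q n" for n
  have binet: "\<alpha> ^ n - \<beta> ^ n = s * of_int (U n)" for n
    using lucas_U_binet[OF sum prod, of n] diff by (simp add: U_def)
  have U_nz: "U n \<noteq> 0" if "n > 0" for n
  proof
    assume "U n = 0"
    then have "\<bar>\<alpha>\<bar> ^ n = \<bar>\<beta>\<bar> ^ n" using binet[of n] by (simp add: power_abs[symmetric])
    then show False using abs_neq that by (simp add: power_eq_iff_eq_base)
  qed
  have "s \<ge> 1" using D_pos by simp
  have U_le: "\<bar>of_int (U n)\<bar> \<le> 2 * M ^ n" for n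
  proof -
    have "\<bar>of_int (U n)\<bar> \<le> s * \<bar>of_int (U n) :: real\<bar>" using \<open>s \<ge> 1\<close> by (simp add: mult_le_cancel_right1)
    also have "\<dots> = \<bar>\<alpha> ^ n - \<beta> ^ n\<bar>" using binet s_pos by (simp add: abs_mult)
    also have "\<dots> \<le> \<bar>\<alpha>\<bar> ^ n + \<bar>\<beta>\<bar> ^ n" by (metis abs_triangle_ineq4 power_abs)
    also have "\<dots> \<le> M ^ n + M ^ n" by (intro add_mono power_mono) (auto simp: M_def)
    finally show ?thesis by simp
  qed
  have "\<exists>C. \<forall>a\<in>K - {0}. \<forall>b\<in>K - {0}. \<forall>c\<in>K - {0}. a + b = c \<longrightarrow>
      abc_height K a b c \<le> (1 + 1 / 2) * abc_radical K a b c + C"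
    using assms(4) unfolding abc_conjecture_def by (meson half_gt_zero_iff zero_less_one)
  then obtain C0 where C0: "\<And>a b c. a \<in> K - {0} \<Longrightarrow> b \<in> K - {0} \<Longrightarrow> c \<in> K - {0} \<Longrightarrow> a + b = c \<Longrightarrow>
      abc_height K a b c \<le> (1 + 1 / 2) * abc_radical K a b c + C0" by blast
  define d where "d = real (field_degree K)"
  define E where "E = 2 * ln (of_int D) + 2 * ln \<bar>of_int A\<bar> + ln (2 :: real)"
  define C where "C = (3 * E + 2 * (d * C0)) / ln M + 1"
  have "real n < C" if n: "n > 0" and r: "r > 0" "r\<^sup>2 dvd U n" "\<forall>p\<in>prime_factors (U n). p dvd A * r" for n r
  proof -
    define a b c where "a = \<alpha> ^ n" and "b = - (\<beta> ^ n)" and "c = s * of_int (U n)"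
    define m where "m = D * \<bar>A\<bar> * r"
    have val: "valuation K \<pp> a = 0" "valuation K \<pp> b = 0" if "\<pp> \<in> places" for \<pp>
      unfolding a_def b_def using valuation_unit_power[OF that] integers unit by blast+
    have abc_K: "a \<in> K - {0}" "b \<in> K - {0}" "c \<in> K - {0}"
      using K nz s_pos U_nz[OF n]
      by (auto simp: a_def b_def c_def intro: K_power K_minus K_mult s_in_K of_int_in_K)
    have abc: "a + b = c" using binet by (simp add: a_def b_def c_def)
    have "M ^ n \<le> max \<bar>a\<bar> \<bar>b\<bar>"
      by (auto simp: M_def a_def b_def power_abs max_def)
    moreover have "M ^ n \<le> max \<bar>conj a\<bar> \<bar>conj b\<bar>"
      using K by (auto simp: M_def a_def b_def power_abs max_def conj_minus conj_power K_power conj)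
    ultimately have "2 * ln (M ^ n) \<le> d * abc_height K a b c"
      unfolding d_def using abc_K val \<open>M > 1\<close> by (intro abc_height_ge) auto
    then have height: "2 * (n * ln M) \<le> d * abc_height K a b c"
      using \<open>M > 1\<close> by (simp add: ln_realpow)
    have "m > 0" using D_pos assms(3) r(1) by (simp add: m_def)
    have "of_int m \<in> \<pp>" if "\<pp> \<in> abc_support K a b c" for \<pp>
    proof -
      have \<pp>: "\<pp> \<in> places" and "valuation K \<pp> c \<noteq> 0" using that val by (auto simp: abc_support_def)
      moreover have "c \<in> integers"
        unfolding c_def by (intro integers_closed[OF \<pp>] s_in_integers of_int_in_integers)
      ultimately have "c \<in> \<pp>" using valuation_eq_0 by blast
      then consider "s \<in> \<pp>" | "of_int (U n) \<in> \<pp>"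
        using place_prime[OF \<pp> s_in_integers of_int_in_integers] by (auto simp: c_def)
      then obtain q where l: "of_int q \<in> \<pp>" "q dvd m"
      proof cases
        case 1
        then have "of_int D \<in> \<pp>" using place_closed(4)[OF \<pp> 1 s_in_integers] s_square by simp
        then show ?thesis using that by (simp add: m_def)
      next
        case 2
        then obtain p where p: "p \<in> prime_factors (U n)" "of_int p \<in> \<pp>"
          using int_in_place_prime_factor[OF \<pp> U_nz[OF n]] by blast
        then have "p dvd A * r" using r(3) by blast
        then have "p dvd \<bar>A\<bar> * r" by (metis abs_mult abs_of_pos dvd_abs_iff r(1))
        then have "p dvd m" unfolding m_def mult.assoc by (rule dvd_mult)
        then show ?thesis using that p(2) by blast
      qed
      then obtain k where "m = q * k" by blast
      then show ?thesis using place_closed(5)[OF \<pp> l(1) of_int_in_integers, of k] by simp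
    qed
    then have "d * abc_radical K a b c \<le> 2 * ln (of_int m)"
      unfolding d_def using \<open>m > 0\<close> by (intro abc_radical_le)
    also have "\<dots> = 2 * ln (of_int D) + 2 * ln \<bar>of_int A\<bar> + ln (of_int (r\<^sup>2))"
      using D_pos assms(3) r(1) by (simp add: m_def ln_mult ln_realpow)
    also have "ln (of_int (r\<^sup>2)) \<le> ln (2 * M ^ n)"
    proof (rule ln_mono)
      have "r\<^sup>2 \<le> \<bar>U n\<bar>" using dvd_imp_le_int[OF U_nz[OF n] r(2)] by simp
      then have "real_of_int (r\<^sup>2) \<le> \<bar>of_int (U n)\<bar>" by linarith
      then show "real_of_int (r\<^sup>2) \<le> 2 * M ^ n" using U_le[of n] by linarith
      show "0 < real_of_int (r\<^sup>2)" using r(1) by simp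
    qed
    also have "ln (2 * M ^ n) = ln 2 + n * ln M" using \<open>M > 1\<close> by (simp add: ln_mult ln_realpow)
    finally have radical: "d * abc_radical K a b c \<le> E + n * ln M" by (simp add: E_def)
    have "d * abc_height K a b c \<le> d * ((1 + 1 / 2) * abc_radical K a b c + C0)"
      using C0[OF abc_K abc] by (intro mult_left_mono) (auto simp: d_def)
    also have "\<dots> = 3 / 2 * (d * abc_radical K a b c) + d * C0" by (simp add: algebra_simps)
    also have "\<dots> \<le> 3 / 2 * (E + n * ln M) + d * C0"
      by (intro add_right_mono mult_left_mono radical) simp
    finally have "2 * (n * ln M) \<le> 3 / 2 * (E + n * ln M) + d * C0" using height by (rule order_trans[rotated])
    then have "n * ln M \<le> 3 * E + 2 * (d * C0)" unfolding distrib_left by linarith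
    then have "real n \<le> (3 * E + 2 * (d * C0)) / ln M" using \<open>M > 1\<close> by (simp add: pos_le_divide_eq)
    then show ?thesis by (simp add: C_def)
  qed
  then show ?thesis using U_nz unfolding U_def by blast
qed

end

section \<open>Coprime index tuples\<close>

text \<open>If the square root were rational, then the two roots would be rational integers with product
  \<open>\<plusminus>1\<close>, and the square of their quotient would be \<open>1\<close>.\<close>

lemma lucas_nondegenerate_imp_irrational:
  assumes "Q = 1 \<or> Q = - 1" "P\<^sup>2 + 4 * Q > 0" "lucas_nondegenerate P Q"
  shows "sqrt (of_int (P\<^sup>2 + 4 * Q)) \<notin> \<rat>"
proof
  define s where "s = sqrt (of_int (P\<^sup>2 + 4 * Q))"
  define \<alpha> \<beta> where "\<alpha> = (of_int P + s) / 2" and "\<beta> = (of_int P - s) / 2"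
  assume "sqrt (of_int (P\<^sup>2 + 4 * Q)) \<in> \<rat>"
  then have rat: "\<alpha> \<in> \<rat>" "\<beta> \<in> \<rat>" by (auto simp: \<alpha>_def \<beta>_def s_def)
  have "real_of_int (P\<^sup>2 + 4 * Q) > 0" using assms(2) by (simp only: of_int_0_less_iff)
  then have "s * s = of_int (P\<^sup>2 + 4 * Q)" unfolding s_def by (simp only: real_sqrt_mult_self abs_of_pos)
  then have sum: "\<alpha> + \<beta> = of_int P" and prod: "\<alpha> * \<beta> = - of_int Q"
    by (simp_all add: \<alpha>_def \<beta>_def field_simps power2_eq_square)
  have "\<alpha>\<^sup>2 = of_int P * \<alpha> + of_int Q" "\<beta>\<^sup>2 = of_int P * \<beta> + of_int Q"
    unfolding sum[symmetric] using prod by (simp_all add: algebra_simps power2_eq_square)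
  then have "\<alpha> \<in> \<int>" "\<beta> \<in> \<int>"
    using rat algebraic_int_quadratic rational_algebraic_int_is_int by blast+
  then obtain a b where ab: "\<alpha> = of_int a" "\<beta> = of_int b" by (auto elim!: Ints_cases)
  then have "real_of_int (a + b) = of_int P" "real_of_int (a * b) = of_int (- Q)"
    using sum prod by simp_all
  then have ab': "P = a + b" "Q = - (a * b)" by linarith+
  have "\<bar>a * b\<bar> = 1" using assms(1) ab'(2) by auto
  then have "\<bar>a\<bar> = 1" "\<bar>b\<bar> = 1" using abs_zmult_eq_1 by (metis mult.commute)+
  then have "(of_int a / of_int b :: complex) ^ 2 = 1" by (auto simp: abs_if split: if_splits)
  moreover have "\<forall>x :: complex. x\<^sup>2 - of_int P * x - of_int Q = (x - of_int a) * (x - of_int b)"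
    unfolding ab' by (simp add: algebra_simps power2_eq_square)
  ultimately show False using assms(3) unfolding lucas_nondegenerate_def by (meson zero_less_numeral)
qed

text \<open>Pairwise coprime entries other than \<open>1\<close> are distinct.\<close>

lemma finite_coprime_lists:
  "finite {filter (\<lambda>n. n \<noteq> 1) ns | ns. coprime_index_tuple ns \<and> set ns \<subseteq> {..N}}"
proof (rule finite_subset)
  show "finite {xs. set xs \<subseteq> {..N} \<and> distinct xs}" by (rule finite_subset_distinct) simp
  have "distinct (filter (\<lambda>n. n \<noteq> 1) ns)" if "coprime_index_tuple ns" for ns
  proof -
    have "sorted_wrt coprime ns"
      using that by (auto simp: sorted_wrt_iff_nth_less coprime_index_tuple_def)
    then have "sorted_wrt coprime (filter (\<lambda>n. n \<noteq> 1) ns)" by (rule sorted_wrt_filter)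
    moreover have "1 \<notin> set (filter (\<lambda>n. n \<noteq> 1) ns)" by simp
    moreover have "distinct xs" if "sorted_wrt coprime xs" "1 \<notin> set xs" for xs :: "nat list"
      using that by (induction xs) auto
    ultimately show ?thesis by blast
  qed
  then show "{filter (\<lambda>n. n \<noteq> 1) ns | ns. coprime_index_tuple ns \<and> set ns \<subseteq> {..N}}
    \<subseteq> {xs. set xs \<subseteq> {..N} \<and> distinct xs}" by auto
qed

theorem corollary7p3:
  fixes P Q A :: int and k :: nat
  assumes "Q = 1 \<or> Q = - 1"
    and "P\<^sup>2 + 4 * Q > 0"
    and "lucas_nondegenerate P Q"
    and "k \<ge> 2"
    and "abc_conjecture (quadratic_field (P\<^sup>2 + 4 * Q))"
    and "A \<noteq> 0"
  shows "(\<exists>C::real. \<forall>ns. lucas_product_tuple P Q A k ns \<longrightarrow> real (Max (set ns)) < C) \<and>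
    finite {filter (\<lambda>n. n \<noteq> 1) ns | ns. lucas_product_tuple P Q A k ns}"
proof -
  interpret real_quadratic "P\<^sup>2 + 4 * Q"
    using assms(2) lucas_nondegenerate_imp_irrational[OF assms(1-3)] by unfold_locales
  obtain C where C: "\<And>n. n > 0 \<Longrightarrow> lucas_U P Q n \<noteq> 0"
    "\<And>n r. n > 0 \<Longrightarrow> r > 0 \<Longrightarrow> r\<^sup>2 dvd lucas_U P Q n \<Longrightarrow>
      (\<forall>p\<in>prime_factors (lucas_U P Q n). p dvd A * r) \<Longrightarrow> real n < C"
    using lucas_index_bounded[OF refl assms(1,6,5)] by blast
  have bound: "real n < C" if ns: "lucas_product_tuple P Q A k ns" and n: "n \<in> set ns" for ns n
  proof -
    from ns obtain y where cop: "coprime_index_tuple ns"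
      and y: "A * y ^ k = (\<Prod>n\<leftarrow>ns. lucas_U P Q n)" by (auto simp: lucas_product_tuple_def)
    obtain i where i: "i < length ns" "n = ns ! i" using n by (auto simp: in_set_conv_nth)
    have "n > 0" using cop n by (simp add: coprime_index_tuple_def)
    define v where "v = (\<Prod>j\<in>{0..<length ns} - {i}. lucas_U P Q (ns ! j))"
    have "A * y ^ k = (\<Prod>j\<in>{0..<length ns}. lucas_U P Q (ns ! j))"
      by (simp add: y prod.list_conv_set_nth)
    also have "\<dots> = lucas_U P Q n * v"
      unfolding v_def i(2) by (rule prod.remove) (use i in auto)
    finally have "A * y ^ k = lucas_U P Q n * v" .
    moreover have "coprime (lucas_U P Q n) v"
      unfolding v_def i(2) using cop i(1) assms(1)
      by (intro prod_coprime_right coprime_lucas_U) (auto simp: coprime_index_tuple_def)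
    ultimately obtain r where "r > 0" "r\<^sup>2 dvd lucas_U P Q n"
      "\<And>p. p \<in> prime_factors (lucas_U P Q n) \<Longrightarrow> p dvd A * r"
      using powerful_part[OF _ _ assms(4) C(1)[OF \<open>n > 0\<close>]] by metis
    then show ?thesis using C(2)[OF \<open>n > 0\<close>] by blast
  qed
  have "real (Max (set ns)) < C" if "lucas_product_tuple P Q A k ns" for ns
  proof (rule bound[OF that], rule Max_in)
    show "set ns \<noteq> {}" using that by (auto simp: lucas_product_tuple_def coprime_index_tuple_def)
  qed simp
  moreover have "finite {filter (\<lambda>n. n \<noteq> 1) ns | ns. lucas_product_tuple P Q A k ns}"
  proof (rule finite_subset[OF _ finite_coprime_lists[of "nat \<lceil>C\<rceil>"]])
    have "set ns \<subseteq> {..nat \<lceil>C\<rceil>}" if "lucas_product_tuple P Q A k ns" for ns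
      using bound[OF that] by (force simp: le_nat_iff le_ceiling_iff dest: less_imp_le)
    then show "{filter (\<lambda>n. n \<noteq> 1) ns | ns. lucas_product_tuple P Q A k ns}
      \<subseteq> {filter (\<lambda>n. n \<noteq> 1) ns | ns. coprime_index_tuple ns \<and> set ns \<subseteq> {..nat \<lceil>C\<rceil>}}"
      by (auto simp: lucas_product_tuple_def)
  qed
  ultimately show ?thesis by blast
qed

end
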